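(* For $n\ge 0$ let $b_{n}$ be the number of words $w=w_1\cdots w_n\in\{1,2,3\}^n$ in which each letter differs from at least one of its neighbors by $1$ or less. Then $$\sum_{n\ge 0}b_nt^n=\frac{1-2t+5t^2+2t^3+t^4}{1-2t-2t^2-t^3},$$ and consequently $$b_n=2b_{n-1}+2b_{n-2}+b_{n-3}\qquad\text{for } n>4 .$$
   Context: The neighbors of the letter $w_i$ in $w=w_1\cdots w_n$ are $w_{i-1}$ (if $i\ge 2$) and $w_{i+1}$ (if $i\le n-1$). So $b_n$ counts words such that for every $i$, $|w_i-w_{i-1}|\le 1$ or $|w_i-w_{i+1}|\le 1$ for some existing neighbor; the empty word counts, so $b_0=1$, and a one-letter word has no neighbors, so $b_1=0$. *)

theory Defs
  imports "HOL-Computational_Algebra.Formal_Power_Series"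
begin

definition words :: "nat \<Rightarrow> int list set" where
  "words n = {w. length w = n \<and> set w \<subseteq> {1, 2, 3}}"

text \<open>Positions are 0-based, as usual for lists.\<close>

definition neighbors :: "nat \<Rightarrow> nat \<Rightarrow> nat set" where
  "neighbors n i = {j. j < n \<and> (i = j + 1 \<or> j = i + 1)}"

definition close_to_neighbor :: "int list \<Rightarrow> bool" where
  "close_to_neighbor w \<longleftrightarrow>
     (\<forall>i<length w. \<exists>j\<in>neighbors (length w) i. \<bar>w ! i - w ! j\<bar> \<le> 1)"

definition b :: "nat \<Rightarrow> nat" where
  "b n = card {w \<in> words n. close_to_neighbor w}"

end

(* Read a word from the left. The letter x in front of y # w has a close neighbor iff it is close
   to y; in that case y has a close neighbor for free, otherwise y still has to be close to the
   first letter of w. Hence the numbers c x n of good words x # w, and d x n of words x # w that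
   are good except possibly at x, satisfy a linear system. Merging the letters 1 and 3 reduces
   it to three unknowns, whose characteristic polynomial is the one of the recurrence. *)
theory Submission
  imports Defs
begin

text \<open>The shift to \<open>Suc i\<close> is the form left over when
  \<open>All_less_Suc2\<close> splits position 0 off \<open>close_to_neighbor\<close>. The first
  letter is exempt but may still serve as the close neighbor of the second.\<close>

definition tail_close :: "int list \<Rightarrow> bool" where
  "tail_close w \<longleftrightarrow>
     (\<forall>i<length w - 1. \<exists>j\<in>neighbors (length w) (Suc i). \<bar>w ! Suc i - w ! j\<bar> \<le> 1)"

lemma neighbors_0: "neighbors (Suc (Suc n)) 0 = {1}"
  by (auto simp: neighbors_def)

lemma neighbors_1: "neighbors (Suc n) (Suc 0) = insert 0 (Suc ` neighbors n 0)"
  by (auto simp: neighbors_def image_iff)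

lemma neighbors_Suc_Suc: "neighbors (Suc n) (Suc (Suc i)) = Suc ` neighbors n (Suc i)"
proof -
  \<comment> \<open>Position 0 is not adjacent to \<open>Suc (Suc i)\<close>, so \<open>j\<close>
    has a predecessor.\<close>
  have "j \<in> Suc ` neighbors n (Suc i)" if "j \<in> neighbors (Suc n) (Suc (Suc i))" for j
    using that by (cases j) (auto simp: neighbors_def)
  then show ?thesis by (auto simp: neighbors_def)
qed

lemma close_to_neighbor_Nil: "close_to_neighbor []"
  by (simp add: close_to_neighbor_def)

lemma not_close_to_neighbor_singleton: "\<not> close_to_neighbor [x]"
  by (simp add: close_to_neighbor_def neighbors_def)

lemma tail_close_singleton: "tail_close [x]"
  by (simp add: tail_close_def)

lemma close_to_neighbor_Cons_Cons:
  "close_to_neighbor (x # y # w) \<longleftrightarrow> \<bar>x - y\<bar> \<le> 1 \<and> tail_close (x # y # w)"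
  by (simp add: close_to_neighbor_def tail_close_def All_less_Suc2 neighbors_0)

text \<open>From position 2 on, neighborhoods are merely shifted by the new letter \<open>x\<close>;
  only the letter \<open>y\<close> gains a candidate.\<close>

lemma tail_close_Cons_Cons:
  "tail_close (x # y # w) \<longleftrightarrow>
     (if \<bar>x - y\<bar> \<le> 1 then tail_close (y # w) else close_to_neighbor (y # w))"
  by (auto simp: close_to_neighbor_def tail_close_def All_less_Suc2 neighbors_1
      neighbors_Suc_Suc abs_minus_commute)

lemma words_0: "words 0 = {[]}"
  by (auto simp: words_def)

lemma finite_words: "finite (words n)"
  using finite_lists_length_eq[of "{1, 2, 3::int}" n] by (simp add: words_def conj_commute)

text \<open>Words are split by their first letter. Leaving \<open>P\<close> arbitrary lets one lemma
  serve \<open>b\<close>, \<open>c\<close> and \<open>d\<close>.\<close>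

lemma card_words_Suc:
  "card {w \<in> words (Suc n). P w} = (\<Sum>x\<in>{1, 2, 3}. card {w \<in> words n. P (x # w)})"
proof -
  have "{w \<in> words (Suc n). P w} = (\<Union>x\<in>{1, 2, 3}. Cons x ` {w \<in> words n. P (x # w)})"
    by (auto simp: words_def length_Suc_conv)
  also have "card \<dots> = (\<Sum>x\<in>{1, 2, 3}. card (Cons x ` {w \<in> words n. P (x # w)}))"
    by (rule card_UN_disjoint) (auto simp: finite_words)
  also have "\<dots> = (\<Sum>x\<in>{1, 2, 3}. card {w \<in> words n. P (x # w)})"
    by (simp add: card_image)
  finally show ?thesis .
qed

definition c :: "int \<Rightarrow> nat \<Rightarrow> nat" where
  "c x n = card {w \<in> words n. close_to_neighbor (x # w)}"

definition d :: "int \<Rightarrow> nat \<Rightarrow> nat" where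
  "d x n = card {w \<in> words n. tail_close (x # w)}"

lemma c_0: "c x 0 = 0"
  by (simp add: c_def words_0 not_close_to_neighbor_singleton)

lemma d_0: "d x 0 = 1"
  by (simp add: d_def words_0 tail_close_singleton Collect_conv_if)

lemma c_Suc: "c x (Suc n) = (\<Sum>y\<in>{1, 2, 3}. if \<bar>x - y\<bar> \<le> 1 then d y n else 0)"
  unfolding c_def d_def card_words_Suc
  by (intro sum.cong) (auto simp: close_to_neighbor_Cons_Cons tail_close_Cons_Cons)

lemma d_Suc: "d x (Suc n) = (\<Sum>y\<in>{1, 2, 3}. if \<bar>x - y\<bar> \<le> 1 then d y n else c y n)"
  unfolding c_def d_def card_words_Suc
  by (intro sum.cong) (auto simp: tail_close_Cons_Cons)

lemma b_0: "b 0 = 1"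
  by (simp add: b_def words_0 close_to_neighbor_Nil Collect_conv_if)

lemma b_Suc: "b (Suc n) = c 1 n + c 2 n + c 3 n"
  by (simp add: b_def c_def card_words_Suc)

lemma b_small: "b (Suc 0) = 0" "b 2 = 7" "b 3 = 17" "b 4 = 49"
proof -
  \<comment> \<open>In unary form the recursions evaluate these values by rewriting.\<close>
  have "b (Suc (Suc 0)) = 7" "b (Suc (Suc (Suc 0))) = 17" "b (Suc (Suc (Suc (Suc 0)))) = 49"
    by (simp_all add: b_Suc c_Suc d_Suc c_0 d_0)
  then show "b 2 = 7" "b 3 = 17" "b 4 = 49"
    by (simp_all only: eval_nat_numeral(2) eval_nat_numeral(3) BitM.simps numeral_One One_nat_def)
  show "b (Suc 0) = 0"
    by (simp add: b_Suc c_0)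
qed

text \<open>With s = d 1 + d 3, v = d 2 and u = c 1 + c 3, one step sends (s, v, u) to (s + 2v + u,
  s + v, s + 2v). This matrix has characteristic polynomial z^3 - 2z^2 - 2z - 1. The letter 2 is
  close to every letter, so \<open>c 2\<close> drops out.\<close>

lemma b_recurrence:
  "b (Suc (Suc (Suc (Suc (Suc m))))) =
     2 * b (Suc (Suc (Suc (Suc m)))) + 2 * b (Suc (Suc (Suc m))) + b (Suc (Suc m))"
proof -
  \<comment> \<open>The coefficients count the letters close to 1 or 3 (two each) and to 2 (three).
    The linear form is available only from \<open>b 2\<close> on, which is why the recurrence starts
    at \<open>b 5\<close>; at \<open>b 4\<close> it would give 48 instead of 49.\<close>
  have b: "b (Suc (Suc n)) = 2 * (d 1 n + d 3 n) + 3 * d 2 n" for n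
    by (simp add: b_Suc c_Suc)
  have c: "c 1 (Suc n) + c 3 (Suc n) = d 1 n + d 3 n + 2 * d 2 n" for n
    by (simp add: c_Suc)
  have d: "d 1 (Suc n) + d 3 (Suc n) = d 1 n + d 3 n + 2 * d 2 n + (c 1 n + c 3 n)" for n
    by (simp add: d_Suc)
  have d2: "d 2 (Suc n) = d 1 n + d 3 n + d 2 n" for n
    by (simp add: d_Suc)
  show ?thesis
    unfolding b d c d2 by simp
qed

theorem mainTheorem8:
  shows "Abs_fps (\<lambda>n. of_nat (b n) :: rat) =
           (1 - 2 * fps_X + 5 * fps_X ^ 2 + 2 * fps_X ^ 3 + fps_X ^ 4)
           / (1 - 2 * fps_X - 2 * fps_X ^ 2 - fps_X ^ 3)
       \<and> (\<forall>n>4. b n = 2 * b (n - 1) + 2 * b (n - 2) + b (n - 3))"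
proof
  show rec: "\<forall>n>4. b n = 2 * b (n - 1) + 2 * b (n - 2) + b (n - 3)"
  proof (intro allI impI)
    fix n :: nat
    assume "n > 4"
    then have "n = Suc (Suc (Suc (Suc (Suc (n - 5)))))" by simp
    then obtain m where n: "n = Suc (Suc (Suc (Suc (Suc m))))" by blast
    then have "n - 1 = Suc (Suc (Suc (Suc m)))" "n - 2 = Suc (Suc (Suc m))" "n - 3 = Suc (Suc m)"
      by simp_all
    with n b_recurrence[of m] show "b n = 2 * b (n - 1) + 2 * b (n - 2) + b (n - 3)"
      by (simp only:)
  qed
  let ?B = "Abs_fps (\<lambda>n. of_nat (b n) :: rat)"
  let ?p = "1 - 2 * fps_X + 5 * fps_X ^ 2 + 2 * fps_X ^ 3 + fps_X ^ 4 :: rat fps"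
  let ?q = "1 - 2 * fps_X - 2 * fps_X ^ 2 - fps_X ^ 3 :: rat fps"
  have "?B * ?q = ?p"
  proof (rule fps_ext)
    fix n :: nat
    \<comment> \<open>With powers of \<open>fps_X\<close> on the left, even
      \<open>fps_X ^ 1\<close>, each product is an index shift for
      \<open>fps_X_power_mult_nth\<close>.\<close>
    have expand: "?B * ?q = ?B - fps_const 2 * (fps_X ^ 1 * ?B) - fps_const 2 * (fps_X ^ 2 * ?B)
        - fps_X ^ 3 * ?B"
      by (simp add: algebra_simps numeral_fps_const)
    have p: "?p = 1 - fps_const 2 * fps_X ^ 1 + fps_const 5 * fps_X ^ 2 + fps_const 2 * fps_X ^ 3
        + fps_X ^ 4"
      by (simp add: numeral_fps_const)
    \<comment> \<open>The numerator has degree 4: its coefficients come from the initial values, and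
      beyond them the recurrence makes the coefficient vanish.\<close>
    consider "n = 0" | "n = 1" | "n = 2" | "n = 3" | "n = 4" | "n > 4" by linarith
    then have "fps_nth (?B - fps_const 2 * (fps_X ^ 1 * ?B) - fps_const 2 * (fps_X ^ 2 * ?B)
        - fps_X ^ 3 * ?B) n =
      fps_nth (1 - fps_const 2 * fps_X ^ 1 + fps_const 5 * fps_X ^ 2 + fps_const 2 * fps_X ^ 3
        + fps_X ^ 4) n"
    proof cases
      case 6
      then have "of_nat (b n) = (of_nat (2 * b (n - 1) + 2 * b (n - 2) + b (n - 3)) :: rat)"
        using rec by presburger
      with 6 show ?thesis by (simp add: fps_X_power_mult_nth)
    qed (simp_all add: b_0 b_small fps_X_power_mult_nth)
    then show "fps_nth (?B * ?q) n = fps_nth ?p n"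
      unfolding expand p .
  qed
  \<comment> \<open>The constant term of the denominator is 1, so it can be cancelled.\<close>
  moreover have "fps_nth ?q 0 \<noteq> 0"
    by simp
  then have "?q \<noteq> 0"
    by (metis fps_zero_nth)
  then have "?B * ?q / ?q = ?B"
    by (rule nonzero_mult_div_cancel_right)
  ultimately show "?B = ?p / ?q"
    by (simp only:)
qed

end
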